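(* Let $n \geq 1$ and $d \geq 2$ be integers and let $\mathbf{x} = (x^1,\ldots,x^d) \in (\mathcal{P}_n)^d$. Then $$\mathrm{EMD}(\mathbf{x}) \geq \frac{1}{d-1}\sum_{1 \leq k < \ell \leq d} \mathrm{EMD}(x^k, x^\ell),$$ with equality if and only if $$X^{(2)}_j = X^{(3)}_j = \cdots = X^{(d-2)}_j = X^{(d-1)}_j \quad \text{for all } 1 \leq j \leq n,$$ i.e. if and only if, for each $1 \le j \le n$, all the values $X^{(i)}_j$ with $2 \leq i \leq d-1$ are equal to one another (a condition that holds trivially when there is at most one such index $i$).
   Context: $\mathcal{P}_n = \{x = (x_1,\ldots,x_{n+1}) \in \mathbb{R}^{n+1} : \sum_j x_j = 1,\ x_j \geq 0\}$ is the standard $n$-simplex, viewed as the set of probability distributions on $[n+1] = \{1,\ldots,n+1\}$. Generalized earth mover's distance: for any integer $e \geq 2$ and $y = (y_1,\ldots,y_e) \in \mathbb{R}^e$, let $C(y) = \min_{a \in \mathbb{R}} \big(|y_1 - a| + \cdots + |y_e - a|\big)$. For $w^1,\ldots,w^e \in \mathcal{P}_n$, with $w^i_j$ the $j$th component of $w^i$, $\mathrm{EMD}(w^1,\ldots,w^e)$ is the minimum of $\sum_{y \in [n+1]^e} C(y)\, T(y)$ over all arrays $T : [n+1]^e \to \mathbb{R}$ such that $T(y) \geq 0$ for all $y$ and $\sum_{y :\, y_i = j} T(y) = w^i_j$ for all $i \in \{1,\ldots,e\}$ and $j \in \{1,\ldots,n+1\}$. Thus $\mathrm{EMD}(\mathbf{x})$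 is the case $e=d$, and $\mathrm{EMD}(x^k,x^\ell)$ is the case $e=2$. Notation for order statistics: for $\mathbf{x} = (x^1,\ldots,x^d)$ and $1 \leq j \leq n$, put $X^i_j = x^i_1 + \cdots + x^i_j$. Let $X^{(i)}_j$ be the $i$th smallest among $X^1_j,\ldots,X^d_j$ (counted with multiplicity). *)

theory Defs
  imports Complex_Main
begin

text \<open>Points of $\mathcal{P}_n$ are functions of which only the values at $1,\ldots,n+1$ matter.
  Tuples are lists, so their entries are numbered from 0, while the $n+1$ coordinates of
  a point of the simplex keep their numbering from 1.\<close>

definition simplex :: "nat \<Rightarrow> (nat \<Rightarrow> real) set" where
  "simplex n = {w. (\<forall>j\<in>{1..n+1}. 0 \<le> w j) \<and> (\<Sum>j=1..n+1. w j) = 1}"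

definition cells :: "nat \<Rightarrow> nat \<Rightarrow> nat list set" where
  "cells n e = {y. length y = e \<and> set y \<subseteq> {1..n+1}}"

text \<open>On the reals \<open>LEAST\<close> denotes the minimum, which is an attained value; it is unspecified
  if there is none.\<close>

definition cost :: "real list \<Rightarrow> real" where
  "cost y = (LEAST c. \<exists>a. c = (\<Sum>t\<leftarrow>y. \<bar>t - a\<bar>))"

definition couplings :: "nat \<Rightarrow> (nat \<Rightarrow> real) list \<Rightarrow> (nat list \<Rightarrow> real) set" where
  "couplings n ws = {T. (\<forall>y\<in>cells n (length ws). 0 \<le> T y) \<and>
     (\<forall>i<length ws. \<forall>j\<in>{1..n+1}.
        (\<Sum>y\<in>{y \<in> cells n (length ws). y ! i = j}. T y) = (ws ! i) j)}"

definition EMD :: "nat \<Rightarrow> (nat \<Rightarrow> real) list \<Rightarrow> real" where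
  "EMD n ws = (LEAST c. \<exists>T\<in>couplings n ws.
     c = (\<Sum>y\<in>cells n (length ws). cost (map real y) * T y))"

text \<open>\<open>order_stat ws i j\<close> is $X^{(i)}_j$, for \<open>1 \<le> i \<le> length ws\<close>; here \<open>i\<close> is
  counted from 1.\<close>

definition cumulative :: "(nat \<Rightarrow> real) \<Rightarrow> nat \<Rightarrow> real" where
  "cumulative w j = (\<Sum>m=1..j. w m)"

definition order_stat :: "(nat \<Rightarrow> real) list \<Rightarrow> nat \<Rightarrow> nat \<Rightarrow> real" where
  "order_stat ws i j = sort (map (\<lambda>w. cumulative w j) ws) ! (i - 1)"

end

theory Submission
  imports Defs "HOL-Analysis.Lebesgue_Measure"
begin

text \<open>The cost of a point of the grid is the sum over \<open>j\<close> of the costs of its indicator vectors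
  \<open>[y_i \<le> j]\<close>. The cost is the maximum of the linear functionals obtained by permuting the weights
  \<open>median_weight\<close>, so averaging over a coupling bounds its total cost below by the sum over \<open>j\<close>
  of the cost of the cumulative vector \<open>X_j\<close>. For the comonotone coupling one permutation is optimal
  for all indicator vectors in the support, so the bound is attained. What remains is an inequality
  for each \<open>j\<close> between two linear functionals of the sorted vector \<open>X_j\<close>.\<close>

section \<open>The cost of a vector as a maximum of linear functionals\<close>

text \<open>Positions count from 0, so the argument of \<open>sgn\<close> is odd under the
  reflection \<open>i\<close> to \<open>d - 1 - i\<close>. The weights are -1 below the middle, 1
  above it and 0 at a middle position, as in a subgradient of the absolute values at the
  median.\<close>

definition median_weight :: "nat \<Rightarrow> nat \<Rightarrow> real" where
  "median_weight d i = sgn (2 * real i + 1 - real d)"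

lemma sum_centered: "(\<Sum>i<d. 2 * real i + 1 - real d) = 0"
proof -
  have "(\<Sum>i<d. 2 * real i + 1) = real d ^ 2"
    by (induction d) (auto simp: power2_eq_square algebra_simps)
  then show ?thesis
    by (simp add: sum_subtractf power2_eq_square)
qed

text \<open>Reversing the index range negates every weight, so the sum equals its own
  negative.\<close>

lemma sum_median_weight: "(\<Sum>i<d. median_weight d i) = 0"
proof -
  have "(\<Sum>i<d. median_weight d i) = (\<Sum>i<d. median_weight d (d - Suc i))"
    by (rule sum.nat_diff_reindex [symmetric])
  also have "\<dots> = (\<Sum>i<d. - median_weight d i)"
  proof (rule sum.cong)
    fix i assume "i \<in> {..<d}"
    then have "2 * real (d - Suc i) + 1 - real d = - (2 * real i + 1 - real d)"
      by (simp add: of_nat_diff)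
    then show "median_weight d (d - Suc i) = - median_weight d i"
      unfolding median_weight_def by (simp only: sgn_minus)
  qed simp
  finally show ?thesis
    by (simp add: sum_negf)
qed

lemma abs_median_weight_le: "\<bar>median_weight d i\<bar> \<le> 1"
  by (simp add: median_weight_def sgn_if)

lemma sum_median_weight_shift:
  "(\<Sum>i<d. median_weight d i * (f i - a)) = (\<Sum>i<d. median_weight d i * f i)"
  by (simp add: right_diff_distrib sum_subtractf sum_median_weight flip: sum_distrib_right)

text \<open>Weak duality: weights in [-1, 1] with total 0 are feasible for the dual of the
  minimization over \<open>a\<close>. The zero total introduces \<open>a\<close>, and the bound on
  the weights passes to absolute values.\<close>

lemma weighted_sum_le_deviation:
  "(\<Sum>i<length s. median_weight (length s) i * s ! i) \<le> (\<Sum>t\<leftarrow>s. \<bar>t - a\<bar>)"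
proof -
  have "(\<Sum>i<length s. median_weight (length s) i * s ! i)
      = (\<Sum>i<length s. median_weight (length s) i * (s ! i - a))"
    by (simp add: sum_median_weight_shift)
  also have "\<dots> \<le> (\<Sum>i<length s. \<bar>s ! i - a\<bar>)"
  proof (rule sum_mono)
    fix i
    have "median_weight (length s) i * (s ! i - a) \<le> \<bar>median_weight (length s) i\<bar> * \<bar>s ! i - a\<bar>"
      by (metis abs_ge_self abs_mult)
    also have "\<dots> \<le> 1 * \<bar>s ! i - a\<bar>"
      by (intro mult_right_mono abs_median_weight_le) simp
    finally show "median_weight (length s) i * (s ! i - a) \<le> \<bar>s ! i - a\<bar>" by simp
  qed
  also have "\<dots> = (\<Sum>t\<leftarrow>s. \<bar>t - a\<bar>)"
    by (simp add: sum_list_sum_nth atLeast0LessThan)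
  finally show ?thesis .
qed

text \<open>Complementary slackness: in a sorted list the weight at \<open>i\<close> is the sign of
  \<open>s ! i - ?m\<close> wherever that difference is nonzero. For even length,
  \<open>length s div 2\<close> is the position of the upper median.\<close>

lemma deviation_from_median:
  assumes "sorted s"
  shows "(\<Sum>t\<leftarrow>s. \<bar>t - s ! (length s div 2)\<bar>)
    = (\<Sum>i<length s. median_weight (length s) i * s ! i)"
proof -
  let ?d = "length s" and ?m = "s ! (length s div 2)"
  have "(\<Sum>t\<leftarrow>s. \<bar>t - ?m\<bar>) = (\<Sum>i<?d. \<bar>s ! i - ?m\<bar>)"
    by (simp add: sum_list_sum_nth atLeast0LessThan)
  also have "\<dots> = (\<Sum>i<?d. median_weight ?d i * (s ! i - ?m))"
  proof (rule sum.cong)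
    fix i assume i: "i \<in> {..<?d}"
    consider "2 * i + 1 < ?d" | "2 * i + 1 = ?d" | "2 * i + 1 > ?d" by linarith
    then show "\<bar>s ! i - ?m\<bar> = median_weight ?d i * (s ! i - ?m)"
    proof cases
      case 1
      then have "s ! i \<le> ?m" using assms by (intro sorted_nth_mono) auto
      moreover have "median_weight ?d i = -1" using 1 by (simp add: median_weight_def sgn_if)
      ultimately show ?thesis by simp
    next
      case 2
      then have "i = ?d div 2" by linarith
      then show ?thesis by simp
    next
      case 3
      then have "?m \<le> s ! i" using assms i by (intro sorted_nth_mono) auto
      moreover have "median_weight ?d i = 1" using 3 by (simp add: median_weight_def sgn_if)
      ultimately show ?thesis by simp
    qed
  qed simp
  finally show ?thesis by (simp add: sum_median_weight_shift)
qed

text \<open>The weighted sum is a deviation sum and bounds all of them from below, so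
  \<open>LEAST\<close> is a genuine minimum here.\<close>

lemma cost_sorted:
  assumes "sorted s"
  shows "cost s = (\<Sum>i<length s. median_weight (length s) i * s ! i)"
  unfolding cost_def
  by (rule Least_equality) (use deviation_from_median [OF assms] weighted_sum_le_deviation in metis)+

lemma sum_list_cong_mset:
  fixes f :: "'a \<Rightarrow> 'b::comm_monoid_add"
  assumes "mset s = mset u"
  shows "(\<Sum>t\<leftarrow>s. f t) = (\<Sum>t\<leftarrow>u. f t)"
  using assms by (metis mset_map sum_mset_sum_list)

lemma cost_cong_mset:
  assumes "mset s = mset u"
  shows "cost s = cost u"
  unfolding cost_def using sum_list_cong_mset [OF assms, of "\<lambda>t. \<bar>t - _\<bar>"] by simp

lemma cost_attained: "\<exists>a. cost s = (\<Sum>t\<leftarrow>s. \<bar>t - a\<bar>)"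
proof -
  have "cost s = cost (sort s)" by (rule cost_cong_mset) simp
  also have "\<dots> = (\<Sum>t\<leftarrow>sort s. \<bar>t - sort s ! (length (sort s) div 2)\<bar>)"
    by (simp only: cost_sorted sorted_sort deviation_from_median)
  also have "\<dots> = (\<Sum>t\<leftarrow>s. \<bar>t - sort s ! (length (sort s) div 2)\<bar>)"
    by (rule sum_list_cong_mset) simp
  finally show ?thesis by blast
qed

lemma weighted_sum_le_cost: "(\<Sum>i<length s. median_weight (length s) i * s ! i) \<le> cost s"
  using cost_attained [of s] weighted_sum_le_deviation [of s] by metis

text \<open>Substitute \<open>c - a\<close> for \<open>a\<close>. With \<open>c = 1\<close> this
  exchanges the indicators of \<open>j < k\<close>, which count layers, for those of
  \<open>k \<le> j\<close>, which cumulative sums measure.\<close>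

lemma cost_reflect: "cost (map (\<lambda>t. c - t) s) = cost s"
proof -
  have "(\<exists>a. v = (\<Sum>t\<leftarrow>s. \<bar>c - t - a\<bar>)) \<longleftrightarrow> (\<exists>a. v = (\<Sum>t\<leftarrow>s. \<bar>t - a\<bar>))" for v
  proof -
    have "(\<Sum>t\<leftarrow>s. \<bar>c - t - a\<bar>) = (\<Sum>t\<leftarrow>s. \<bar>t - (c - a)\<bar>)" for a
      by (intro arg_cong [of _ _ sum_list] map_cong) auto
    moreover have "(\<Sum>t\<leftarrow>s. \<bar>t - a\<bar>) = (\<Sum>t\<leftarrow>s. \<bar>c - t - (c - a)\<bar>)" for a
      by (intro arg_cong [of _ _ sum_list] map_cong) auto
    ultimately show ?thesis by metis
  qed
  then show ?thesis by (simp add: cost_def o_def)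
qed

lemma mset_map_nth_perm:
  assumes "mset p = mset [0..<length u]"
  shows "mset (map ((!) u) p) = mset u"
  using assms by (metis map_nth mset_map)

text \<open>The permutation is a list \<open>p\<close> of positions rather than a rearranged
  \<open>u\<close>, so that the same \<open>p\<close> can be applied both to a cumulative vector and
  to the cells of a coupling.\<close>

lemma weighted_sum_perm_le_cost:
  assumes "mset p = mset [0..<length u]"
  shows "(\<Sum>i<length u. median_weight (length u) i * u ! (p ! i)) \<le> cost u"
proof -
  have "length p = length u" using assms by (metis diff_zero length_upt size_mset)
  then show ?thesis
    using weighted_sum_le_cost [of "map ((!) u) p"] cost_cong_mset [OF mset_map_nth_perm [OF assms]]
    by simp
qed

lemma weighted_sum_perm_eq_cost:
  assumes "mset p = mset [0..<length u]" and "sorted (map ((!) u) p)"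
  shows "(\<Sum>i<length u. median_weight (length u) i * u ! (p ! i)) = cost u"
proof -
  have "length p = length u" using assms by (metis diff_zero length_upt size_mset)
  then show ?thesis
    using cost_sorted [OF assms(2)] cost_cong_mset [OF mset_map_nth_perm [OF assms(1)]]
    by simp
qed

section \<open>Decomposition of the grid cost into layers\<close>

text \<open>An integer \<open>k\<close> in the range is 1 plus the number of \<open>j\<close> with
  \<open>j < k\<close>. Sorting \<open>y\<close> sorts all its indicator vectors at once, and on
  vectors sorted by a common order the cost is linear.\<close>

lemma cost_layers:
  assumes "set y \<subseteq> {1..n+1}"
  shows "cost (map real y) = (\<Sum>j=1..n. cost (map (\<lambda>k. of_bool (k \<le> j)) y))"
proof -
  let ?d = "length y" and ?s = "sort y"
  have layers: "real k = 1 + (\<Sum>j=1..n. of_bool (j < k))" if "k \<in> {1..n+1}" for k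
  proof -
    have "(\<Sum>j=1..n. of_bool (j < k)) = real (card {j\<in>{1..n}. j < k})"
      by (simp add: sum.If_cases of_bool_def Int_def)
    also have "{j\<in>{1..n}. j < k} = {1..<k}" using that by auto
    finally show ?thesis using that by (simp add: of_nat_diff)
  qed
  have "cost (map real y) = cost (map real ?s)" by (rule cost_cong_mset) simp
  also have "\<dots> = (\<Sum>i<?d. median_weight ?d i * real (?s ! i))"
    by (subst cost_sorted) (auto simp: sorted_map intro: sorted_wrt_mono_rel [OF _ sorted_sort])
  \<comment> \<open>The weights sum to 0, so the constant 1 in \<open>layers\<close> can be
    removed.\<close>
  also have "\<dots> = (\<Sum>i<?d. median_weight ?d i * (real (?s ! i) - 1))"
    by (simp add: sum_median_weight_shift)
  also have "\<dots> = (\<Sum>i<?d. \<Sum>j=1..n. median_weight ?d i * of_bool (j < ?s ! i))"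
  proof (rule sum.cong)
    fix i assume "i \<in> {..<?d}"
    then have "?s ! i \<in> {1..n+1}"
      using assms by (metis length_sort lessThan_iff nth_mem set_sort subsetD)
    then have "real (?s ! i) - 1 = (\<Sum>j=1..n. of_bool (j < ?s ! i))"
      using layers by (simp del: sum_of_bool_eq)
    then show "median_weight ?d i * (real (?s ! i) - 1) =
        (\<Sum>j=1..n. median_weight ?d i * of_bool (j < ?s ! i))"
      by (simp only: sum_distrib_left)
  qed simp
  also have "\<dots> = (\<Sum>j=1..n. \<Sum>i<?d. median_weight ?d i * of_bool (j < ?s ! i))"
    by (rule sum.swap)
  also have "\<dots> = (\<Sum>j=1..n. cost (map (\<lambda>k. of_bool (k \<le> j)) y))"
  proof (rule sum.cong)
    fix j
    have "(\<Sum>i<?d. median_weight ?d i * of_bool (j < ?s ! i)) = cost (map (\<lambda>k. of_bool (j < k)) ?s)"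
      by (subst cost_sorted) (auto simp: sorted_map intro: sorted_wrt_mono_rel [OF _ sorted_sort])
    also have "\<dots> = cost (map (\<lambda>k. of_bool (j < k)) y)"
      by (rule cost_cong_mset) simp
    also have "\<dots> = cost (map (\<lambda>t. 1 - t) (map (\<lambda>k. of_bool (k \<le> j)) y))"
      by (rule arg_cong [of _ _ cost]) auto
    finally show "(\<Sum>i<?d. median_weight ?d i * of_bool (j < ?s ! i))
        = cost (map (\<lambda>k. of_bool (k \<le> j)) y)"
      by (simp only: cost_reflect)
  qed simp
  finally show ?thesis .
qed

section \<open>Marginals of a coupling and the cost of one layer\<close>

lemma finite_cells [simp]: "finite (cells n e)"
  unfolding cells_def using finite_lists_length_eq [of "{1..n+1}" e] by (simp add: conj_commute)

lemma cumulative_marginal: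
  assumes "T \<in> couplings n ws" and "i < length ws" and "j \<le> n"
  shows "(\<Sum>y\<in>cells n (length ws). of_bool (y ! i \<le> j) * T y) = cumulative (ws ! i) j"
proof -
  let ?C = "cells n (length ws)"
  have "cumulative (ws ! i) j = (\<Sum>m=1..j. \<Sum>y\<in>{y\<in>?C. y ! i = m}. T y)"
    using assms by (auto simp: cumulative_def couplings_def intro!: sum.cong)
  also have "\<dots> = (\<Sum>m=1..j. \<Sum>y\<in>?C. of_bool (y ! i = m) * T y)"
    by (rule sum.cong [OF refl], rule sum.mono_neutral_cong_left) auto
  also have "\<dots> = (\<Sum>y\<in>?C. \<Sum>m=1..j. of_bool (y ! i = m) * T y)"
    by (rule sum.swap)
  also have "\<dots> = (\<Sum>y\<in>?C. of_bool (y ! i \<le> j) * T y)"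
  proof (rule sum.cong)
    fix y assume "y \<in> ?C"
    \<comment> \<open>Entries are at least 1, so \<open>y ! i \<le> j\<close> holds exactly when one
      \<open>m\<close> in \<open>{1..j}\<close> equals \<open>y ! i\<close>.\<close>
    then have "y ! i \<in> {1..n+1}"
      using assms(2) unfolding cells_def by (metis (mono_tags) mem_Collect_eq nth_mem subsetD)
    then have "(\<Sum>m=1..j. of_bool (y ! i = m)) = (of_bool (y ! i \<le> j) :: real)"
      by (auto simp: of_bool_def)
    then show "(\<Sum>m=1..j. of_bool (y ! i = m) * T y) = of_bool (y ! i \<le> j) * T y"
      by (metis sum_distrib_right)
  qed simp
  finally show ?thesis by simp
qed

text \<open>Averaging against \<open>T\<close> commutes with a fixed linear functional, so the
  result depends on \<open>T\<close> only through its marginals.\<close>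

lemma weighted_marginals:
  assumes T: "T \<in> couplings n ws" and p: "mset p = mset [0..<length ws]" and j: "j \<le> n"
  shows "(\<Sum>y\<in>cells n (length ws).
      (\<Sum>i<length ws. median_weight (length ws) i * of_bool (y ! (p ! i) \<le> j)) * T y)
    = (\<Sum>i<length ws. median_weight (length ws) i * cumulative (ws ! (p ! i)) j)"
proof -
  let ?d = "length ws"
  have "(\<Sum>y\<in>cells n ?d. (\<Sum>i<?d. median_weight ?d i * of_bool (y ! (p ! i) \<le> j)) * T y)
      = (\<Sum>i<?d. median_weight ?d i * (\<Sum>y\<in>cells n ?d. of_bool (y ! (p ! i) \<le> j) * T y))"
    unfolding sum_distrib_right sum_distrib_left by (subst sum.swap) (simp only: mult.assoc)
  also have "\<dots> = (\<Sum>i<?d. median_weight ?d i * cumulative (ws ! (p ! i)) j)"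
  proof (rule sum.cong)
    fix i assume "i \<in> {..<?d}"
    then have "p ! i < ?d"
      using p by (metis atLeastLessThan_iff diff_zero length_upt lessThan_iff nth_mem set_mset_mset
          set_upt size_mset)
    then show "median_weight ?d i * (\<Sum>y\<in>cells n ?d. of_bool (y ! (p ! i) \<le> j) * T y)
        = median_weight ?d i * cumulative (ws ! (p ! i)) j"
      using cumulative_marginal [OF T _ j] by simp
  qed simp
  finally show ?thesis .
qed

lemma cumulative_sorting_perm:
  obtains p where "mset p = mset [0..<length ws]"
    and "sorted (map (\<lambda>i. cumulative (ws ! i) j) p)"
  using that [of "sort_key (\<lambda>i. cumulative (ws ! i) j) [0..<length ws]"] by simp

lemma cost_cumulative_perm:
  assumes "mset p = mset [0..<length ws]" and "sorted (map (\<lambda>i. cumulative (ws ! i) j) p)"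
  shows "cost (map (\<lambda>w. cumulative w j) ws)
    = (\<Sum>i<length ws. median_weight (length ws) i * cumulative (ws ! (p ! i)) j)"
proof -
  let ?u = "map (\<lambda>w. cumulative w j) ws"
  have lt: "k < length ws" if "k \<in> set p" for k
    using that assms(1) by (metis atLeastLessThan_iff set_mset_mset set_upt)
  have len: "length p = length ws" using assms(1) by (metis diff_zero length_upt size_mset)
  have eq: "map ((!) ?u) p = map (\<lambda>i. cumulative (ws ! i) j) p"
    using lt by simp
  have "cost ?u = (\<Sum>i<length ?u. median_weight (length ?u) i * ?u ! (p ! i))"
    by (rule weighted_sum_perm_eq_cost [symmetric]) (simp_all only: eq assms length_map)
  then show ?thesis using lt len by simp
qed

text \<open>Jensen's inequality for the convex function \<open>cost\<close>: the permutation that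
  sorts the cumulative vector gives a supporting functional there, and this functional stays below
  the cost at every cell.\<close>

lemma layer_cost_ge:
  assumes T: "T \<in> couplings n ws" and j: "j \<le> n"
  shows "cost (map (\<lambda>w. cumulative w j) ws)
    \<le> (\<Sum>y\<in>cells n (length ws). cost (map (\<lambda>k. of_bool (k \<le> j)) y) * T y)"
proof -
  obtain p where p: "mset p = mset [0..<length ws]" "sorted (map (\<lambda>i. cumulative (ws ! i) j) p)"
    by (rule cumulative_sorting_perm)
  have lt: "p ! i < length ws" if "i < length ws" for i
    using that p(1) by (metis atLeastLessThan_iff diff_zero length_upt nth_mem set_mset_mset
          set_upt size_mset)
  show ?thesis
    unfolding cost_cumulative_perm [OF p] weighted_marginals [OF T p(1) j, symmetric]
  proof (rule sum_mono)
    fix y assume y: "y \<in> cells n (length ws)"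
    then have [simp]: "length y = length ws" by (simp add: cells_def)
    have "(\<Sum>i<length ws. median_weight (length ws) i * of_bool (y ! (p ! i) \<le> j))
        \<le> cost (map (\<lambda>k. of_bool (k \<le> j)) y)"
      using weighted_sum_perm_le_cost [of p "map (\<lambda>k. of_bool (k \<le> j)) y"] p(1) lt by simp
    moreover have "0 \<le> T y" using T y by (simp add: couplings_def)
    ultimately show "(\<Sum>i<length ws. median_weight (length ws) i * of_bool (y ! (p ! i) \<le> j)) * T y
        \<le> cost (map (\<lambda>k. of_bool (k \<le> j)) y) * T y"
      by (rule mult_right_mono)
  qed
qed

text \<open>On the support, the indicator of \<open>y ! i \<le> j\<close> is a nondecreasing
  function of the cumulative value, with a threshold \<open>t\<close> that may depend on
  \<open>y\<close>. The permutation sorting the cumulative vector therefore sorts the indicators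
  too, and Jensen's inequality becomes an equality.\<close>

lemma layer_cost_eq:
  assumes T: "T \<in> couplings n ws" and j: "j \<le> n"
    and comonotone: "\<And>y. y \<in> cells n (length ws) \<Longrightarrow> T y \<noteq> 0 \<Longrightarrow>
      \<exists>t. \<forall>i<length ws. y ! i \<le> j \<longleftrightarrow> t \<le> cumulative (ws ! i) j"
  shows "(\<Sum>y\<in>cells n (length ws). cost (map (\<lambda>k. of_bool (k \<le> j)) y) * T y)
    = cost (map (\<lambda>w. cumulative w j) ws)"
proof -
  obtain p where p: "mset p = mset [0..<length ws]" "sorted (map (\<lambda>i. cumulative (ws ! i) j) p)"
    by (rule cumulative_sorting_perm)
  have len: "length p = length ws" using p(1) by (metis diff_zero length_upt size_mset)
  have lt: "p ! i < length ws" if "i < length ws" for i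
    using that p(1) by (metis atLeastLessThan_iff diff_zero length_upt nth_mem set_mset_mset
          set_upt size_mset)
  show ?thesis
    unfolding cost_cumulative_perm [OF p] weighted_marginals [OF T p(1) j, symmetric]
  proof (rule sum.cong)
    fix y assume y: "y \<in> cells n (length ws)"
    then have [simp]: "length y = length ws" by (simp add: cells_def)
    show "cost (map (\<lambda>k. of_bool (k \<le> j)) y) * T y
        = (\<Sum>i<length ws. median_weight (length ws) i * of_bool (y ! (p ! i) \<le> j)) * T y"
    proof (cases "T y = 0")
      case False
      obtain t where t: "\<And>i. i < length ws \<Longrightarrow> y ! i \<le> j \<longleftrightarrow> t \<le> cumulative (ws ! i) j"
        using comonotone [OF y False] by blast
      have "sorted (map ((!) (map (\<lambda>k. of_bool (k \<le> j) :: real) y)) p)"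
        unfolding sorted_iff_nth_mono
      proof (intro allI impI)
        fix a b
        assume "a \<le> b" and "b < length (map ((!) (map (\<lambda>k. of_bool (k \<le> j) :: real) y)) p)"
        moreover from this have "cumulative (ws ! (p ! a)) j \<le> cumulative (ws ! (p ! b)) j"
          using sorted_nth_mono [OF p(2), of a b] by simp
        ultimately show "map ((!) (map (\<lambda>k. of_bool (k \<le> j) :: real) y)) p ! a
            \<le> map ((!) (map (\<lambda>k. of_bool (k \<le> j))  y)) p ! b"
          using t [OF lt, of a] t [OF lt, of b] lt [of a] lt [of b] len by (auto simp: of_bool_def)
      qed
      then show ?thesis
        using weighted_sum_perm_eq_cost [of p "map (\<lambda>k. of_bool (k \<le> j)) y"] p(1) lt by simp
    qed simp
  qed simp
qed

section \<open>The comonotone coupling\<close>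

lemma cumulative_mono:
  assumes "w \<in> simplex n" and "i \<le> j" and "j \<le> n + 1"
  shows "cumulative w i \<le> cumulative w j"
  unfolding cumulative_def using assms by (intro sum_mono2) (auto simp: simplex_def)

text \<open>The mass of \<open>y\<close> is the length of the intersection of the quantile intervals of the marginals;
  the witness \<open>t\<close> is a point of that intersection.\<close>

lemma comonotone_coupling_exists:
  assumes ws: "set ws \<subseteq> simplex n"
  obtains T where "T \<in> couplings n ws"
    and "\<And>y j. y \<in> cells n (length ws) \<Longrightarrow> T y \<noteq> 0 \<Longrightarrow> j \<le> n \<Longrightarrow>
      \<exists>t. \<forall>i<length ws. y ! i \<le> j \<longleftrightarrow> t \<le> cumulative (ws ! i) j"
proof -
  let ?C = "cells n (length ws)"
  \<comment> \<open>These are the level sets of the quantile function of the \<open>i\<close>th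
    marginal. They tile \<open>{0<..1}\<close> as \<open>k\<close> runs through
    \<open>{1..n+1}\<close>; the first starts at \<open>cumulative (ws ! i) 0 = 0\<close>, and
    values of mass 0 get empty intervals.\<close>
  define I where "I i k = {cumulative (ws ! i) (k - 1)<..cumulative (ws ! i) k}" for i k
  \<comment> \<open>The factor \<open>{0<..1}\<close> bounds \<open>B y\<close> also when
    \<open>ws\<close> is empty and the intersection over \<open>i\<close> is the whole line.\<close>
  define B where "B y = {0<..1} \<inter> (\<Inter>i\<in>{..<length ws}. I i (y ! i))" for y
  define T where "T y = measure lborel (B y)" for y
  have in_simplex: "ws ! i \<in> simplex n" if "i < length ws" for i
    using ws that nth_mem by blast
  \<comment> \<open>The Galois connection between quantile function and distribution function:
    \<open>k\<close> is the quantile at \<open>t\<close>.\<close>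
  have I_le_iff: "k \<le> j \<longleftrightarrow> t \<le> cumulative (ws ! i) j"
    if "i < length ws" "t \<in> I i k" "k \<in> {1..n+1}" "j \<le> n + 1" for i k j t
  proof (cases "k \<le> j")
    case True
    then show ?thesis
      using cumulative_mono [OF in_simplex, of i k j] that by (auto simp: I_def)
  next
    case False
    then have "cumulative (ws ! i) j \<le> cumulative (ws ! i) (k - 1)"
      using cumulative_mono [OF in_simplex, of i j "k - 1"] that by auto
    then show ?thesis using False that by (auto simp: I_def)
  qed
  have I_unique: "k = k'"
    if "i < length ws" "t \<in> I i k" "t \<in> I i k'" "k \<in> {1..n+1}" "k' \<in> {1..n+1}" for i k k' t
  proof (rule antisym)
    show "k \<le> k'" using I_le_iff [OF that(1,2,4), of k'] that by (auto simp: I_def)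
    show "k' \<le> k" using I_le_iff [OF that(1,3,5), of k] that by (auto simp: I_def)
  qed
  have I_exists: "\<exists>k\<in>{1..n+1}. t \<in> I i k" if "i < length ws" "t \<in> {0<..1}" for i t
  proof -
    \<comment> \<open>The quantile at \<open>t\<close> is the first index whose cumulative value
      reaches \<open>t\<close>; it is positive because the value at 0 is 0, below
      \<open>t\<close>.\<close>
    define k where "k = (LEAST k. t \<le> cumulative (ws ! i) k)"
    have top: "t \<le> cumulative (ws ! i) (n + 1)"
      using in_simplex [OF that(1)] that(2) by (simp add: simplex_def cumulative_def)
    have k: "t \<le> cumulative (ws ! i) k" unfolding k_def using top by (rule LeastI)
    have "k \<le> n + 1" unfolding k_def using top by (rule Least_le)
    moreover have "k \<noteq> 0" using k that(2) by (cases k) (auto simp: cumulative_def)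
    moreover have "\<not> t \<le> cumulative (ws ! i) (k - 1)"
      unfolding k_def by (rule not_less_Least) (use \<open>k \<noteq> 0\<close> in \<open>simp add: k_def\<close>)
    ultimately show ?thesis using k by (intro bexI [of _ k]) (auto simp: I_def)
  qed
  have I_unit: "I i k \<subseteq> {0<..1}" if "i < length ws" "k \<in> {1..n+1}" for i k
  proof -
    have "cumulative (ws ! i) k \<le> 1"
      using cumulative_mono [OF in_simplex [OF that(1)], of k "n + 1"] in_simplex [OF that(1)] that(2)
      by (simp add: simplex_def cumulative_def)
    moreover have "0 \<le> cumulative (ws ! i) (k - 1)"
      using cumulative_mono [OF in_simplex [OF that(1)], of 0 "k - 1"] that(2)
      by (auto simp: cumulative_def)
    ultimately show ?thesis by (auto simp: I_def)
  qed
  have cell_nth: "y ! i \<in> {1..n+1}" if "y \<in> ?C" "i < length ws" for y i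
    using that unfolding cells_def by (metis (mono_tags) mem_Collect_eq nth_mem subsetD)
  have B_meas: "B y \<in> fmeasurable lborel" for y
  proof (rule fmeasurableI2 [of "{0<..1}"])
    show "{0<..1::real} \<in> fmeasurable lborel"
      by (intro fmeasurableI) auto
    show "B y \<in> sets lborel"
    proof (cases "length ws = 0")
      case True then show ?thesis by (simp add: B_def)
    next
      case False
      then show ?thesis unfolding B_def I_def by (intro sets.Int sets.finite_INT) auto
    qed
  qed (auto simp: B_def)
  have disj: "B y \<inter> B y' = {}" if "y \<in> ?C" "y' \<in> ?C" "y \<noteq> y'" for y y'
  proof -
    have "length y = length ws" "length y' = length ws" using that by (simp_all add: cells_def)
    with that(3) obtain i where i: "i < length ws" "y ! i \<noteq> y' ! i"
      by (metis nth_equalityI)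
    have "y ! i = y' ! i" if "t \<in> B y" "t \<in> B y'" for t
    proof (rule I_unique [OF i(1), of t])
      show "t \<in> I i (y ! i)" "t \<in> I i (y' ! i)" using that i(1) by (simp_all add: B_def)
      show "y ! i \<in> {1..n+1}" "y' ! i \<in> {1..n+1}"
        using cell_nth [OF \<open>y \<in> ?C\<close> i(1)] cell_nth [OF \<open>y' \<in> ?C\<close> i(1)] .
    qed
    with i(2) show ?thesis by blast
  qed
  have "T \<in> couplings n ws"
    unfolding couplings_def
  proof (intro CollectI conjI ballI allI impI)
    show "0 \<le> T y" for y by (simp add: T_def)
  next
    fix i k assume i: "i < length ws" and k: "k \<in> {1..n+1}"
    let ?S = "{y\<in>?C. y ! i = k}"
    have "(\<Sum>y\<in>?S. T y) = measure lborel (\<Union>y\<in>?S. B y)"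
      unfolding T_def
    proof (rule measure_finite_Union [symmetric])
      show "disjoint_family_on B ?S" using disj by (auto simp: disjoint_family_on_def)
      show "emeasure lborel (B y) \<noteq> \<infinity>" for y
        using fmeasurableD2 [OF B_meas] by simp
    qed (use fmeasurableD [OF B_meas] in auto)
    also have "(\<Union>y\<in>?S. B y) = I i k"
    proof (intro equalityI subsetI)
      fix t assume "t \<in> (\<Union>y\<in>?S. B y)"
      then show "t \<in> I i k" using i by (auto simp: B_def)
    next
      fix t assume t: "t \<in> I i k"
      then have t01: "t \<in> {0<..1}" using I_unit i k by blast
      \<comment> \<open>The quantiles of all marginals at the same \<open>t\<close> form a cell
        whose set \<open>B\<close> contains \<open>t\<close>.\<close>
      obtain q where q: "\<And>m. m < length ws \<Longrightarrow> q m \<in> {1..n+1} \<and> t \<in> I m (q m)"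
        using I_exists [OF _ t01] by metis
      define y where "y = map q [0..<length ws]"
      have "y \<in> ?C" using q by (auto simp: y_def cells_def)
      moreover have "y ! i = k" using I_unique [OF i _ t _ k] q [OF i] i by (simp add: y_def)
      moreover have "t \<in> B y" using t01 q by (auto simp: B_def y_def)
      ultimately show "t \<in> (\<Union>y\<in>?S. B y)" by blast
    qed
    also have "measure lborel (I i k) = cumulative (ws ! i) k - cumulative (ws ! i) (k - 1)"
      unfolding I_def using cumulative_mono [OF in_simplex [OF i], of "k - 1" k] k by simp
    also have "\<dots> = (ws ! i) k"
      using k by (cases k) (auto simp: cumulative_def)
    finally show "(\<Sum>y\<in>?S. T y) = (ws ! i) k" .
  qed
  moreover have "\<exists>t. \<forall>i<length ws. y ! i \<le> j \<longleftrightarrow> t \<le> cumulative (ws ! i) j"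
    if "y \<in> ?C" "T y \<noteq> 0" "j \<le> n" for y j
  proof -
    have "B y \<noteq> {}" using that(2) by (auto simp: T_def)
    then obtain t where "t \<in> B y" by blast
    then have "\<forall>i<length ws. y ! i \<le> j \<longleftrightarrow> t \<le> cumulative (ws ! i) j"
      using I_le_iff cell_nth [OF that(1)] that(3) by (simp add: B_def)
    then show ?thesis by blast
  qed
  ultimately show thesis using that by blast
qed

section \<open>Closed form of the distance\<close>

text \<open>Bounding the layers separately loses nothing, because the comonotone coupling is chosen
  independently of \<open>j\<close> and attains the bound in every layer.\<close>

theorem EMD_eq_sum_cost_cumulative:
  assumes "set ws \<subseteq> simplex n"
  shows "EMD n ws = (\<Sum>j=1..n. cost (map (\<lambda>w. cumulative w j) ws))"
proof -
  let ?C = "cells n (length ws)"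
  have split: "(\<Sum>y\<in>?C. cost (map real y) * T y)
      = (\<Sum>j=1..n. \<Sum>y\<in>?C. cost (map (\<lambda>k. of_bool (k \<le> j)) y) * T y)" for T
  proof -
    have "(\<Sum>y\<in>?C. cost (map real y) * T y)
        = (\<Sum>y\<in>?C. \<Sum>j=1..n. cost (map (\<lambda>k. of_bool (k \<le> j)) y) * T y)"
      by (intro sum.cong refl) (auto simp: cells_def cost_layers sum_distrib_right)
    then show ?thesis by (simp add: sum.swap [of _ ?C])
  qed
  obtain T where T: "T \<in> couplings n ws"
    and comonotone: "\<And>y j. y \<in> ?C \<Longrightarrow> T y \<noteq> 0 \<Longrightarrow> j \<le> n \<Longrightarrow>
      \<exists>t. \<forall>i<length ws. y ! i \<le> j \<longleftrightarrow> t \<le> cumulative (ws ! i) j"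
    using comonotone_coupling_exists [OF assms] by metis
  show ?thesis
    unfolding EMD_def
  proof (rule Least_equality)
    have "(\<Sum>j=1..n. cost (map (\<lambda>w. cumulative w j) ws)) = (\<Sum>y\<in>?C. cost (map real y) * T y)"
      unfolding split by (intro sum.cong refl layer_cost_eq [symmetric] T comonotone) auto
    with T show "\<exists>T\<in>couplings n ws. (\<Sum>j=1..n. cost (map (\<lambda>w. cumulative w j) ws))
        = (\<Sum>y\<in>?C. cost (map real y) * T y)" by blast
  next
    fix c assume "\<exists>T\<in>couplings n ws. c = (\<Sum>y\<in>?C. cost (map real y) * T y)"
    then obtain T' where T': "T' \<in> couplings n ws" "c = (\<Sum>y\<in>?C. cost (map real y) * T' y)"
      by blast
    show "(\<Sum>j=1..n. cost (map (\<lambda>w. cumulative w j) ws)) \<le> c"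
      unfolding T'(2) split by (intro sum_mono layer_cost_ge T') auto
  qed
qed

section \<open>Pairwise differences and the comparison at one level\<close>

lemma cost_pair: "cost [a, b] = \<bar>a - b\<bar>"
proof -
  have "cost [a, b] = cost [min a b, max a b]"
    by (rule cost_cong_mset) (auto simp: min_def max_def)
  also have "\<dots> = \<bar>a - b\<bar>"
    by (subst cost_sorted) (auto simp: median_weight_def lessThan_Suc min_def max_def)
  finally show ?thesis .
qed

text \<open>Passing to the full square of indices makes the sum visibly invariant under permutations
  of the entries, which allows sorting.\<close>

lemma sum_pairs_symmetric:
  fixes f :: "nat \<Rightarrow> nat \<Rightarrow> real"
  assumes "\<And>k l. f k l = f l k" and "\<And>k. f k k = 0"
  shows "2 * (\<Sum>(k, l)\<in>{(k, l). k < l \<and> l < d}. f k l) = (\<Sum>k<d. \<Sum>l<d. f k l)"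
proof -
  let ?P = "{(k, l). k < l \<and> l < d}" and ?Q = "{(k, l). l < k \<and> k < d}"
    and ?D = "(\<lambda>k. (k, k)) ` {..<d}"
  have fin: "finite ?P" "finite ?Q"
    by (rule finite_subset [of _ "{..<d} \<times> {..<d}"]; auto)+
  have "(\<Sum>(k, l)\<in>?Q. f k l) = (\<Sum>(k, l)\<in>?P. f k l)"
    by (rule sum.reindex_bij_witness [of _ prod.swap prod.swap]) (auto simp: assms(1))
  moreover have "(\<Sum>(k, l)\<in>?D. f k l) = 0"
    by (rule sum.neutral) (auto simp: assms(2))
  moreover have "(\<Sum>k<d. \<Sum>l<d. f k l) = (\<Sum>(k, l)\<in>(?P \<union> ?Q) \<union> ?D. f k l)"
    unfolding sum.cartesian_product by (rule sum.cong) (auto simp: image_iff)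
  moreover have "\<dots> = (\<Sum>(k, l)\<in>?P. f k l) + (\<Sum>(k, l)\<in>?Q. f k l) + (\<Sum>(k, l)\<in>?D. f k l)"
    using fin by (subst sum.union_disjoint, simp, simp, force)+ simp
  ultimately show ?thesis by simp
qed

text \<open>In the sorted list, entry \<open>i\<close> is added in its \<open>i\<close> pairs with
  earlier entries and subtracted in its \<open>d - 1 - i\<close> pairs with later ones, which leaves
  the coefficient \<open>2 * i + 1 - d\<close>.\<close>

lemma sum_pairs_abs_diff:
  fixes z :: "real list"
  assumes "length z = d"
  shows "(\<Sum>(k, l)\<in>{(k, l). k < l \<and> l < d}. \<bar>z ! k - z ! l\<bar>)
    = (\<Sum>i<d. (2 * real i + 1 - real d) * sort z ! i)"
proof -
  let ?P = "{(k, l). k < l \<and> l < d}" and ?s = "sort z"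
  have double: "2 * (\<Sum>(k, l)\<in>?P. \<bar>u ! k - u ! l\<bar>) = (\<Sum>a\<leftarrow>u. \<Sum>b\<leftarrow>u. \<bar>a - b\<bar>)"
    if "length u = d" for u :: "real list"
    using that by (subst sum_pairs_symmetric) (auto simp: sum_list_sum_nth atLeast0LessThan)
  \<comment> \<open>The list is sorted in the inner sum first, then in the outer one.\<close>
  have "(\<Sum>b\<leftarrow>z. \<bar>a - b\<bar>) = (\<Sum>b\<leftarrow>?s. \<bar>a - b\<bar>)" for a
    by (rule sum_list_cong_mset) simp
  then have "(\<Sum>a\<leftarrow>z. \<Sum>b\<leftarrow>z. \<bar>a - b\<bar>) = (\<Sum>a\<leftarrow>z. \<Sum>b\<leftarrow>?s. \<bar>a - b\<bar>)"
    by simp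
  also have "\<dots> = (\<Sum>a\<leftarrow>?s. \<Sum>b\<leftarrow>?s. \<bar>a - b\<bar>)"
    by (rule sum_list_cong_mset) simp
  finally have "(\<Sum>(k, l)\<in>?P. \<bar>z ! k - z ! l\<bar>) = (\<Sum>(k, l)\<in>?P. \<bar>?s ! k - ?s ! l\<bar>)"
    using double [of z] double [of ?s] assms by simp
  also have "\<dots> = (\<Sum>(k, l)\<in>?P. ?s ! l - ?s ! k)"
    using assms
    by (intro sum.cong refl) (clarsimp simp: abs_of_nonpos sorted_nth_mono)
  also have "\<dots> = (\<Sum>(k, l)\<in>?P. ?s ! l) - (\<Sum>(k, l)\<in>?P. ?s ! k)"
    by (simp add: sum_subtractf case_prod_unfold)
  also have "(\<Sum>(k, l)\<in>?P. ?s ! l) = (\<Sum>(l, k)\<in>(SIGMA l:{..<d}. {..<l}). ?s ! l)"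
    by (rule sum.reindex_bij_witness [of _ prod.swap prod.swap]) auto
  also have "\<dots> = (\<Sum>i<d. real i * ?s ! i)"
    by (subst sum.Sigma [symmetric]) auto
  also have "(\<Sum>(k, l)\<in>?P. ?s ! k) = (\<Sum>(k, l)\<in>(SIGMA k:{..<d}. {Suc k..<d}). ?s ! k)"
    by (rule sum.cong) auto
  also have "\<dots> = (\<Sum>i<d. real (d - Suc i) * ?s ! i)"
    by (subst sum.Sigma [symmetric]) auto
  also have "(\<Sum>i<d. real i * ?s ! i) - (\<Sum>i<d. real (d - Suc i) * ?s ! i)
      = (\<Sum>i<d. (2 * real i + 1 - real d) * ?s ! i)"
    unfolding sum_subtractf [symmetric]
    by (intro sum.cong refl) (simp add: of_nat_diff algebra_simps)
  finally show ?thesis .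
qed

text \<open>After subtracting the median from every entry, the difference of the two sides is a sum whose
  terms are nonnegative one by one, with coefficients vanishing only at the two extremes and
  (for odd \<open>d\<close>) at the median itself.\<close>

lemma cost_vs_pairs:
  fixes z :: "real list"
  assumes d: "d \<ge> 2" and z: "length z = d"
  defines "P \<equiv> 1 / (real d - 1) * (\<Sum>(k, l)\<in>{(k, l). k < l \<and> l < d}. \<bar>z ! k - z ! l\<bar>)"
  shows "P \<le> cost z"
    and "cost z = P \<longleftrightarrow> (\<forall>i\<in>{2..d-1}. \<forall>i'\<in>{2..d-1}. sort z ! (i - 1) = sort z ! (i' - 1))"
proof -
  define s where "s = sort z"
  define m where "m = s ! (d div 2)"
  \<comment> \<open>These coefficients govern both sides: their signs give the cost, and their
    quotients by \<open>d - 1\<close> give \<open>P\<close>.\<close>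
  define c where "c i = 2 * real i + 1 - real d" for i
  define g where "g i = (sgn (c i) - c i / (real d - 1)) * (s ! i - m)" for i
  have s: "sorted s" "length s = d" using z by (auto simp: s_def)
  have cost: "cost z = (\<Sum>i<d. sgn (c i) * (s ! i - m))"
    using cost_cong_mset [of z s] cost_sorted [OF s(1)]
      sum_median_weight_shift [where d = d and a = m and f = "(!) s"]
    by (simp add: s_def z median_weight_def c_def)
  have P: "P = (\<Sum>i<d. c i / (real d - 1) * (s ! i - m))"
  proof -
    have "P = 1 / (real d - 1) * (\<Sum>i<d. c i * s ! i)"
      using sum_pairs_abs_diff [OF z] by (simp add: P_def c_def s_def)
    moreover have "(\<Sum>i<d. c i) = 0"
      unfolding c_def by (rule sum_centered)
    then have "(\<Sum>i<d. c i * s ! i) = (\<Sum>i<d. c i * (s ! i - m))"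
      by (simp add: right_diff_distrib sum_subtractf flip: sum_distrib_right)
    ultimately show ?thesis by (simp add: sum_distrib_left mult.assoc)
  qed
  have diff: "cost z - P = (\<Sum>i<d. g i)"
    unfolding cost P g_def by (simp add: sum_subtractf left_diff_distrib)
  have below: "s ! i \<le> m" if "i \<le> d div 2" for i
    unfolding m_def using that s d by (intro sorted_nth_mono) auto
  have above: "m \<le> s ! i" if "d div 2 \<le> i" "i < d" for i
    unfolding m_def using that s d by (intro sorted_nth_mono) auto
  have g: "0 \<le> g i \<and> (g i = 0 \<longleftrightarrow> i = 0 \<or> i = d - 1 \<or> s ! i = m)" if i: "i < d" for i
  proof -
    consider "2 * i + 1 < d" | "2 * i + 1 = d" | "2 * i + 1 > d" by linarith
    then show ?thesis
    proof cases
      case 1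
      \<comment> \<open>Here \<open>sgn (c i)\<close> is -1, and \<open>-1 - c i / (d - 1)\<close>
        equals \<open>-2 * i / (d - 1)\<close>, which vanishes only at \<open>i = 0\<close>. The
        upper half is the mirror image.\<close>
      then have "g i = (2 * real i / (real d - 1)) * (m - s ! i)"
        using d by (simp add: g_def c_def sgn_if field_simps)
      moreover have "s ! i \<le> m" using 1 by (intro below) simp
      ultimately show ?thesis using d 1 by auto
    next
      case 2
      then have "i = d div 2" by linarith
      then show ?thesis by (simp add: g_def m_def)
    next
      case 3
      then have "g i = (2 * real (d - 1 - i) / (real d - 1)) * (s ! i - m)"
        using d i by (simp add: g_def c_def sgn_if field_simps of_nat_diff)
      moreover have "m \<le> s ! i" using 3 i by (intro above) auto
      ultimately show ?thesis using d 3 i by auto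
    qed
  qed
  then have "0 \<le> (\<Sum>i<d. g i)" by (intro sum_nonneg) simp
  with diff show "P \<le> cost z" by simp
  have "cost z = P \<longleftrightarrow> (\<Sum>i<d. g i) = 0" using diff by auto
  also have "\<dots> \<longleftrightarrow> (\<forall>i<d. g i = 0)"
    using g by (subst sum_nonneg_eq_0_iff) auto
  also have "\<dots> \<longleftrightarrow> (\<forall>i<d. i = 0 \<or> i = d - 1 \<or> s ! i = m)"
    using g by blast
  \<comment> \<open>From positions counted from 0 to order statistics counted from 1: the excluded 0
    and \<open>d - 1\<close> become 1 and \<open>d\<close>.\<close>
  also have "\<dots> \<longleftrightarrow> (\<forall>i\<in>{2..d-1}. s ! (i - 1) = m)"
  proof
    assume *: "\<forall>i\<in>{2..d-1}. s ! (i - 1) = m"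
    show "\<forall>i<d. i = 0 \<or> i = d - 1 \<or> s ! i = m"
    proof (intro allI impI)
      fix i assume "i < d"
      moreover have "s ! i = m" if "i \<noteq> 0" "i \<noteq> d - 1"
        using * [rule_format, of "Suc i"] that \<open>i < d\<close> by simp
      ultimately show "i = 0 \<or> i = d - 1 \<or> s ! i = m" by blast
    qed
  next
    assume *: "\<forall>i<d. i = 0 \<or> i = d - 1 \<or> s ! i = m"
    show "\<forall>i\<in>{2..d-1}. s ! (i - 1) = m"
    proof
      fix i assume "i \<in> {2..d-1}"
      then have i: "i - 1 < d" "i - 1 \<noteq> 0" "i - 1 \<noteq> d - 1" by auto
      show "s ! (i - 1) = m" using * [rule_format, OF i(1)] i(2,3) by argo
    qed
  qed
  also have "\<dots> \<longleftrightarrow> (\<forall>i\<in>{2..d-1}. \<forall>i'\<in>{2..d-1}. s ! (i - 1) = s ! (i' - 1))"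
  proof
    assume *: "\<forall>i\<in>{2..d-1}. \<forall>i'\<in>{2..d-1}. s ! (i - 1) = s ! (i' - 1)"
    show "\<forall>i\<in>{2..d-1}. s ! (i - 1) = m"
    proof
      fix i assume i: "i \<in> {2..d-1}"
      \<comment> \<open>A member \<open>i\<close> of the range forces \<open>d\<close> to be at
        least 3, and then the position of \<open>m\<close>, counted from 1, lies in the range as
        well.\<close>
      then have "Suc (d div 2) \<in> {2..d-1}" by auto
      then have "s ! (i - 1) = s ! (Suc (d div 2) - 1)" by (rule * [rule_format, OF i])
      then show "s ! (i - 1) = m" by (simp add: m_def)
    qed
  qed simp
  finally show "cost z = P \<longleftrightarrow> (\<forall>i\<in>{2..d-1}. \<forall>i'\<in>{2..d-1}. sort z ! (i - 1) = sort z ! (i' - 1))"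
    by (simp only: s_def)
qed

section \<open>Summation of the comparison over all levels\<close>

theorem corollary5p3:
  fixes n d :: nat and x :: "(nat \<Rightarrow> real) list"
  assumes "n \<ge> 1" and "d \<ge> 2"
    and "length x = d" and "set x \<subseteq> simplex n"
  shows "EMD n x \<ge> 1 / (real d - 1) * (\<Sum>(k, l)\<in>{(k, l). k < l \<and> l < d}. EMD n [x ! k, x ! l])
    \<and> (EMD n x = 1 / (real d - 1) * (\<Sum>(k, l)\<in>{(k, l). k < l \<and> l < d}. EMD n [x ! k, x ! l])
        \<longleftrightarrow> (\<forall>j\<in>{1..n}. \<forall>i\<in>{2..d-1}. \<forall>i'\<in>{2..d-1}. order_stat x i j = order_stat x i' j))"
proof -
  let ?P = "{(k, l). k < l \<and> l < d}"
  define X where "X j = map (\<lambda>w. cumulative w j) x" for j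
  define Q where "Q j = 1 / (real d - 1) * (\<Sum>(k, l)\<in>?P. \<bar>X j ! k - X j ! l\<bar>)" for j
  have len: "length (X j) = d" for j using assms(3) by (simp add: X_def)
  have emd: "EMD n x = (\<Sum>j=1..n. cost (X j))"
    using EMD_eq_sum_cost_cumulative [OF assms(4)] by (simp add: X_def)
  have "(\<Sum>(k, l)\<in>?P. EMD n [x ! k, x ! l]) = (\<Sum>(k, l)\<in>?P. \<Sum>j=1..n. \<bar>X j ! k - X j ! l\<bar>)"
  proof (rule sum.cong)
    fix q assume "q \<in> ?P"
    then obtain k l where q: "q = (k, l)" "k < d" "l < d" by auto
    then have "set [x ! k, x ! l] \<subseteq> simplex n" using assms(3,4) nth_mem by auto
    then show "(case q of (k, l) \<Rightarrow> EMD n [x ! k, x ! l])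
        = (case q of (k, l) \<Rightarrow> \<Sum>j=1..n. \<bar>X j ! k - X j ! l\<bar>)"
      using EMD_eq_sum_cost_cumulative [of "[x ! k, x ! l]" n] q assms(3)
      by (simp add: cost_pair X_def)
  qed simp
  also have "\<dots> = (\<Sum>j=1..n. \<Sum>(k, l)\<in>?P. \<bar>X j ! k - X j ! l\<bar>)"
    unfolding case_prod_unfold by (rule sum.swap)
  finally have pairs: "1 / (real d - 1) * (\<Sum>(k, l)\<in>?P. EMD n [x ! k, x ! l]) = (\<Sum>j=1..n. Q j)"
    by (simp add: Q_def sum_distrib_left)
  have le: "Q j \<le> cost (X j)" for j
    unfolding Q_def by (rule cost_vs_pairs(1) [OF assms(2) len])
  \<comment> \<open>All differences \<open>cost (X j) - Q j\<close> are nonnegative, so their sum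
    vanishes only if equality holds at each level.\<close>
  have "EMD n x = (\<Sum>j=1..n. Q j) \<longleftrightarrow> (\<Sum>j=1..n. cost (X j) - Q j) = 0"
    by (simp add: emd sum_subtractf)
  also have "\<dots> \<longleftrightarrow> (\<forall>j\<in>{1..n}. cost (X j) = Q j)"
    using le by (subst sum_nonneg_eq_0_iff) auto
  also have "\<dots> \<longleftrightarrow> (\<forall>j\<in>{1..n}. \<forall>i\<in>{2..d-1}. \<forall>i'\<in>{2..d-1}.
      order_stat x i j = order_stat x i' j)"
    unfolding Q_def cost_vs_pairs(2) [OF assms(2) len] order_stat_def by (simp only: X_def)
  finally show ?thesis
    unfolding pairs using le by (auto simp: emd intro: sum_mono)
qed

end
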